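(* Let $k\ge 2$, let $f_i:\operatorname{dom}(f_i)\subseteq\mathbb{R}^n\to\mathbb{R}$ for $i\in\{1,\ldots,k\}$, and let $\mathcal{X}=\langle x^0,x^0+d^1,\ldots,x^0+d^m\rangle$ be an ordered set of $m+1$ distinct points such that $\mathcal{X}\cup\mathcal{X}^-$ is contained in $\operatorname{dom}(f_i)$ for all $i$. Then $$\nabla^c(f_1\cdots f_k)(\mathcal{X})=\sum_{i=1}^k\Big(\prod_{j\ne i}f_j(x^0)\Big)\nabla^c f_i(\mathcal{X})+E^c_{f_1\cdots f_k}(\mathcal{X}),$$ where $E^c_{f_1\cdots f_k}(\mathcal{X})=\tfrac12\left(E^s_{f_1\cdots f_k}(\mathcal{X})+E^s_{f_1\cdots f_k}(\mathcal{X}^-)\right)$ and, for $\mathcal{Z}\in\{\mathcal{X},\mathcal{X}^-\}$, $$E^s_{f_1\cdots f_k}(\mathcal{Z})=(S(\mathcal{Z})^\top)^\dagger\Big(\delta^s_{f_1\cdots f_k}(\mathcal{Z})-\sum_{i=1}^k\Big(\prod_{j\ne i}f_j(x^0)\Big)\delta^s_{f_i}(\mathcal{Z})\Big).$$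
   Context: $A^\dagger$ denotes the Moore--Penrose pseudoinverse of a matrix $A$. For an ordered set $\mathcal{Z}=\langle z^0,z^0+e^1,\ldots,z^0+e^m\rangle$ in $\mathbb{R}^n$ put $S(\mathcal{Z})=[e^1\ \cdots\ e^m]\in\mathbb{R}^{n\times m}$ and $\mathcal{Z}^-=\langle z^0,z^0-e^1,\ldots,z^0-e^m\rangle$ (so $S(\mathcal{Z}^-)=-S(\mathcal{Z})$). For a real-valued function $h$, $\delta^s_h(\mathcal{Z})\in\mathbb{R}^m$ has $i$-th entry $h(z^0+e^i)-h(z^0)$, and $\delta^c_h(\mathcal{Z})\in\mathbb{R}^m$ has $i$-th entry $\tfrac12\big(h(z^0+e^i)-h(z^0-e^i)\big)$. The generalized centred simplex gradient of $h$ over $\mathcal{Z}$ is $\nabla^c h(\mathcal{Z})=(S(\mathcal{Z})^\top)^\dagger\delta^c_h(\mathcal{Z})$. Here $f_1\cdots f_k$ is the pointwise product. *)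

theory Defs
  imports "HOL-Analysis.Analysis"
begin

text \<open>
  The Moore--Penrose pseudoinverse is the unique solution of Penrose's four equations (over the reals,
  the conjugate transpose is the transpose).
\<close>

definition is_pinv :: "real^'c^'r \<Rightarrow> real^'r^'c \<Rightarrow> bool" where
  "is_pinv A X \<longleftrightarrow>
     A ** X ** A = A \<and>
     X ** A ** X = X \<and>
     transpose (A ** X) = A ** X \<and>
     transpose (X ** A) = X ** A"

definition pinv :: "real^'c^'r \<Rightarrow> real^'r^'c" where
  "pinv A = (THE X. is_pinv A X)"

lemma is_pinv_unique:
  assumes "is_pinv A X" and "is_pinv A Y"
  shows "X = Y"
proof -
  have AXY: "A ** X = A ** Y"
  proof -
    have "A ** X = transpose ((A ** Y ** A) ** X)"
      using assms by (simp add: is_pinv_def)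
    also have "\<dots> = transpose ((A ** Y) ** (A ** X))"
      by (simp add: matrix_mul_assoc)
    also have "\<dots> = (A ** X) ** (A ** Y)"
      using assms by (subst matrix_transpose_mul) (simp add: is_pinv_def)
    also have "\<dots> = A ** Y"
      using assms by (simp add: matrix_mul_assoc is_pinv_def)
    finally show ?thesis .
  qed
  have XYA: "X ** A = Y ** A"
  proof -
    have "X ** A = transpose (X ** (A ** Y ** A))"
      using assms by (simp add: is_pinv_def)
    also have "\<dots> = transpose ((X ** A) ** (Y ** A))"
      by (simp add: matrix_mul_assoc)
    also have "\<dots> = (Y ** A) ** (X ** A)"
      using assms by (subst matrix_transpose_mul) (simp add: is_pinv_def)
    also have "\<dots> = Y ** (A ** X ** A)"
      by (simp add: matrix_mul_assoc)
    also have "\<dots> = Y ** A"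
      using assms by (simp add: is_pinv_def)
    finally show ?thesis .
  qed
  have "X = X ** (A ** X)"
    using assms by (simp add: is_pinv_def matrix_mul_assoc)
  also have "\<dots> = (X ** A) ** Y"
    by (simp add: AXY matrix_mul_assoc)
  also have "\<dots> = Y"
    using assms by (simp add: XYA is_pinv_def)
  finally show ?thesis .
qed

lemma normal_equations_solvable:
  fixes A :: "real^'c^'r"
  shows "\<exists>G. transpose A ** A ** G = transpose A"
proof -
  have "\<exists>v. transpose A *v (A *v v) = transpose A *v w" for w
  proof -
    obtain y z where y: "y \<in> span (range ((*v) A))"
      and z: "\<And>u. u \<in> span (range ((*v) A)) \<Longrightarrow> orthogonal z u" and w: "w = y + z"
      using orthogonal_subspace_decomp_exists[of "range ((*v) A)" w] by metis
    have "subspace (range ((*v) A))"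
      by (intro linear_subspace_image matrix_vector_mul_linear subspace_UNIV)
    then have "span (range ((*v) A)) = range ((*v) A)"
      by (rule iffD2[OF span_eq_iff])
    then obtain v where v: "y = A *v v"
      using y by (metis rangeE)
    have "inner (transpose A *v z) u = 0" for u
      using z[of "A *v u"] by (simp add: span_base orthogonal_def dot_lmul_matrix)
    then have "transpose A *v z = 0"
      using inner_eq_zero_iff by blast
    then have "transpose A *v (A *v v) = transpose A *v w"
      by (simp only: w v matrix_vector_right_distrib add_0_right)
    then show ?thesis by blast
  qed
  then obtain g where g: "\<And>w. transpose A *v (A *v g w) = transpose A *v w" by metis
  define G where "G = (\<chi> i j. g (axis j 1) $ i)"
  have "column j (transpose A ** A ** G) = column j (transpose A)" for j
  proof -
    have "G *v axis j 1 = g (axis j 1)"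
      by (simp add: matrix_vector_mult_basis G_def column_def)
    then have "(transpose A ** A ** G) *v axis j 1 = transpose A *v axis j 1"
      using g[of "axis j 1"]
      by (simp del: transpose_matrix_vector add: matrix_vector_mul_assoc[symmetric])
    then show ?thesis
      by (simp only: matrix_vector_mult_basis)
  qed
  then have "transpose A ** A ** G = transpose A"
    by (simp add: column_def vec_eq_iff)
  then show ?thesis by blast
qed

lemma is_pinv_exists: "\<exists>X. is_pinv A X"
proof -
  obtain G where "transpose A ** A ** G = transpose A"
    using normal_equations_solvable by blast
  then have G: "transpose A ** (A ** G) = transpose A"
    by (simp add: matrix_mul_assoc)
  obtain H where "transpose (transpose A) ** transpose A ** H = transpose (transpose A)"
    using normal_equations_solvable by blast
  then have H: "A ** (transpose A ** H) = A"
    by (simp add: matrix_mul_assoc)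
  have "transpose (A ** G) ** A = A"
    using arg_cong[OF G, of transpose] by (simp add: matrix_transpose_mul matrix_mul_assoc)
  then have symG: "transpose (A ** G) = A ** G"
    by (metis matrix_mul_assoc matrix_transpose_mul transpose_transpose)
  have AGA: "A ** G ** A = A"
    using \<open>transpose (A ** G) ** A = A\<close> symG by simp
  have symH: "transpose (transpose A ** H) = transpose A ** H"
    by (metis H matrix_mul_assoc matrix_transpose_mul transpose_transpose)
  let ?K = "transpose H"
  have KA: "?K ** A = transpose A ** H"
    using symH by (simp add: matrix_transpose_mul)
  have AKA: "A ** ?K ** A = A"
    using H KA by (metis matrix_mul_assoc)
  have AX: "A ** (?K ** A ** G) = A ** G"
    by (metis AKA matrix_mul_assoc)
  have XA: "(?K ** A ** G) ** A = ?K ** A"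
    by (metis AGA matrix_mul_assoc)
  have XAX: "?K ** A ** (?K ** A ** G) = ?K ** A ** G"
    by (metis AKA matrix_mul_assoc)
  have "is_pinv A (?K ** A ** G)"
    unfolding is_pinv_def AX XA XAX AGA using symG symH KA by simp
  then show ?thesis by blast
qed

lemma is_pinv_pinv: "is_pinv A (pinv A)"
  unfolding pinv_def by (rule theI') (use is_pinv_exists is_pinv_unique in blast)

text \<open>
  The pair \<open>(z, e)\<close> stands for the ordered set \<open>\<langle>z, z + e 1, \<dots>, z + e m\<rangle>\<close>; it is given by its
  first point and its displacements, which are indexed by the finite type \<open>'m\<close>.
\<close>

type_synonym ('n, 'm) ordered_set = "(real^'n) \<times> ('m \<Rightarrow> real^'n)"

definition points :: "('n::finite, 'm::finite) ordered_set \<Rightarrow> (real^'n) set" where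
  "points Z = insert (fst Z) (range (\<lambda>i. fst Z + snd Z i))"

definition reflect :: "('n::finite, 'm::finite) ordered_set \<Rightarrow> ('n, 'm) ordered_set" where
  "reflect Z = (fst Z, \<lambda>i. - snd Z i)"

definition S_mat :: "('n::finite, 'm::finite) ordered_set \<Rightarrow> real^'m^'n" where
  "S_mat Z = (\<chi> r c. snd Z c $ r)"

text \<open>
  A function \<open>h : dom(h) \<subseteq> \<real>\<^sup>n \<rightarrow> \<real>\<close> is a partial map.  The value \<open>the (h x)\<close> is meaningful only
  for \<open>x \<in> dom h\<close>.
\<close>

definition delta_s :: "(real^'n \<rightharpoonup> real) \<Rightarrow> ('n::finite, 'm::finite) ordered_set \<Rightarrow> real^'m" where
  "delta_s h Z = (\<chi> i. the (h (fst Z + snd Z i)) - the (h (fst Z)))"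

definition delta_c :: "(real^'n \<rightharpoonup> real) \<Rightarrow> ('n::finite, 'm::finite) ordered_set \<Rightarrow> real^'m" where
  "delta_c h Z = (\<chi> i. 1/2 * (the (h (fst Z + snd Z i)) - the (h (fst Z - snd Z i))))"

definition nabla_c :: "(real^'n \<rightharpoonup> real) \<Rightarrow> ('n::finite, 'm::finite) ordered_set \<Rightarrow> real^'n" where
  "nabla_c h Z = pinv (transpose (S_mat Z)) *v delta_c h Z"

definition prod_map :: "nat \<Rightarrow> (nat \<Rightarrow> (real^'n \<rightharpoonup> real)) \<Rightarrow> (real^'n \<rightharpoonup> real)" where
  "prod_map k f = (\<lambda>x. if \<forall>i\<in>{1..k}. x \<in> dom (f i)
                        then Some (\<Prod>i\<in>{1..k}. the (f i x)) else None)"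

text \<open>
  \<open>Z\<close> and \<open>reflect Z\<close> have the same first point, so \<open>fst Z\<close> is \<open>x\<^sup>0\<close> in both error terms below.
\<close>

definition E_s :: "nat \<Rightarrow> (nat \<Rightarrow> (real^'n \<rightharpoonup> real)) \<Rightarrow> ('n::finite, 'm::finite) ordered_set \<Rightarrow> real^'n" where
  "E_s k f Z = pinv (transpose (S_mat Z)) *v
     (delta_s (prod_map k f) Z
        - (\<Sum>i\<in>{1..k}. (\<Prod>j\<in>{1..k} - {i}. the (f j (fst Z))) *\<^sub>R delta_s (f i) Z))"

definition E_c :: "nat \<Rightarrow> (nat \<Rightarrow> (real^'n \<rightharpoonup> real)) \<Rightarrow> ('n::finite, 'm::finite) ordered_set \<Rightarrow> real^'n" where
  "E_c k f X = (1/2) *\<^sub>R (E_s k f X + E_s k f (reflect X))"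

end

theory Submission
  imports Defs
begin

text \<open>
  The centred difference is the antisymmetrisation of the simple one:
  \<open>\<delta>\<^sup>c h Z = (\<delta>\<^sup>s h Z - \<delta>\<^sup>s h Z\<^sup>-) / 2\<close>, since the value at the common first point cancels
  (\<open>delta_c_eq\<close>).  On the other side, reflection negates the displacement matrix, and the pseudoinverse
  is an odd function of its argument (\<open>pinv_minus\<close>), so the operator applied in \<open>E_s k f Z\<^sup>-\<close> is the
  negative of the one applied in \<open>E_s k f Z\<close>.  The two signs match: averaging the two simple error
  terms is the same as replacing every simple difference by the centred one (\<open>E_c_eq\<close>).  The
  pseudoinverse acts linearly, so the error term is exactly the difference between the centred gradient
  of the product and the combination of gradients given by the product rule.
\<close>

lemma matrix_mul_minus_left: "(- A) ** B = - (A ** B)"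
  for A :: "real^'k^'r" and B :: "real^'c^'k"
  by (simp add: matrix_matrix_mult_def vec_eq_iff sum_negf)

lemma matrix_mul_minus_right: "A ** (- B) = - (A ** B)"
  for A :: "real^'k^'r" and B :: "real^'c^'k"
  by (simp add: matrix_matrix_mult_def vec_eq_iff sum_negf)

lemma matrix_vector_mult_minus_left: "(- A) *v x = - (A *v x)"
  for A :: "real^'c^'r"
  using matrix_vector_mult_diff_rdistrib[of 0 A x] by simp

lemma transpose_minus: "transpose (- A) = - transpose A"
  for A :: "real^'c^'r"
  by (simp add: transpose_def vec_eq_iff)

text \<open>
  In each Penrose equation the numbers of factors on the two sides have the same parity, so the
  equation survives the simultaneous change of sign of the matrix and its pseudoinverse.
\<close>

lemma pinv_minus: "pinv (- A) = - pinv A"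
proof (rule is_pinv_unique)
  show "is_pinv (- A) (pinv (- A))"
    by (rule is_pinv_pinv)
  show "is_pinv (- A) (- pinv A)"
    using is_pinv_pinv[of A]
    by (simp add: is_pinv_def matrix_mul_minus_left matrix_mul_minus_right)
qed

lemma S_mat_reflect: "S_mat (reflect Z) = - S_mat Z"
  by (simp add: S_mat_def reflect_def vec_eq_iff)

lemma delta_c_eq: "delta_c h Z = (1/2) *\<^sub>R (delta_s h Z - delta_s h (reflect Z))"
  by (simp add: delta_c_def delta_s_def reflect_def vec_eq_iff)

text \<open>
  The negative sign of the second simple error term comes from the pseudoinverse, whose argument is
  negated by the reflection, and it turns the average of the two terms into half a difference.
\<close>

lemma E_c_eq:
  fixes Z :: "('n::finite, 'm::finite) ordered_set"
  shows "E_c k f Z = pinv (transpose (S_mat Z)) *v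
     (delta_c (prod_map k f) Z
        - (\<Sum>i\<in>{1..k}. (\<Prod>j\<in>{1..k} - {i}. the (f j (fst Z))) *\<^sub>R delta_c (f i) Z))"
proof -
  let ?P = "pinv (transpose (S_mat Z))"
  define w where "w i = (\<Prod>j\<in>{1..k} - {i}. the (f j (fst Z)))" for i
  define r where "r Y = delta_s (prod_map k f) Y - (\<Sum>i\<in>{1..k}. w i *\<^sub>R delta_s (f i) Y)"
    for Y :: "('n, 'm) ordered_set"
  have "fst (reflect Z) = fst Z"
    by (simp add: reflect_def)
  then have "E_s k f Z = ?P *v r Z" and "E_s k f (reflect Z) = - (?P *v r (reflect Z))"
    by (simp_all add: E_s_def r_def w_def S_mat_reflect transpose_minus pinv_minus
        matrix_vector_mult_minus_left)
  then have "E_c k f Z = ?P *v ((1/2) *\<^sub>R (r Z - r (reflect Z)))"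
    by (simp add: E_c_def matrix_vector_mult_scaleR matrix_vector_mult_diff_distrib)
  also have "(1/2) *\<^sub>R (r Z - r (reflect Z))
      = delta_c (prod_map k f) Z - (\<Sum>i\<in>{1..k}. w i *\<^sub>R delta_c (f i) Z)"
    by (simp add: r_def delta_c_eq algebra_simps scaleR_sum_right sum_subtractf)
  finally show ?thesis
    by (simp add: w_def)
qed

theorem corollary4p3:
  fixes k :: nat
    and f :: "nat \<Rightarrow> (real^'n \<rightharpoonup> real)"
    and x0 :: "real^'n"
    and d :: "'m::finite \<Rightarrow> real^'n"
  assumes "k \<ge> 2"
    and "card (points (x0, d)) = CARD('m) + 1"
    and "\<And>i. i \<in> {1..k} \<Longrightarrow> points (x0, d) \<union> points (reflect (x0, d)) \<subseteq> dom (f i)"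
  shows "nabla_c (prod_map k f) (x0, d) =
           (\<Sum>i\<in>{1..k}. (\<Prod>j\<in>{1..k} - {i}. the (f j x0)) *\<^sub>R nabla_c (f i) (x0, d))
             + E_c k f (x0, d)"
proof -
  let ?P = "pinv (transpose (S_mat (x0, d)))"
  have "?P *v (\<Sum>i\<in>{1..k}. (\<Prod>j\<in>{1..k} - {i}. the (f j x0)) *\<^sub>R delta_c (f i) (x0, d))
      = (\<Sum>i\<in>{1..k}. (\<Prod>j\<in>{1..k} - {i}. the (f j x0)) *\<^sub>R nabla_c (f i) (x0, d))"
    by (simp add: nabla_c_def linear_sum[OF matrix_vector_mul_linear] matrix_vector_mult_scaleR)
  then show ?thesis
    by (simp add: E_c_eq nabla_c_def matrix_vector_mult_diff_distrib)
qed

end
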